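(* Let $\Phi=\{\phi_1,\dots,\phi_r\}$ be a subset of $A$ (with $r$ elements). (1) $\Phi$ is functionally independent if and only if the set of vectors $\nabla\Phi=\{\nabla\phi_1,\dots,\nabla\phi_r\}$ is linearly independent in the $A$-vector space $A^n$ (as a family of $r$ vectors). (2) If $r>n$ then $\Phi$ is functionally dependent; hence there exist in $A$ no more than $n$ functionally independent elements. If $r\le n$ then $\Phi$ is functionally independent if and only if the matrix $(\partial_i\phi_j)_{i\in[1,n],\,j\in[1,r]}$ over $A$ has rank $r$.
   Context: $A$ is a field of characteristic $0$, and $K\cong\mathbb{Q}$ is its subfield generated by $1$. $A$ is generated as a field by a set $\{x_1,\dots,x_n\}$ of $n$ distinct elements, different from $0$ and $1$, which is functionally independent. A finite set $\{\phi_1,\dots,\phi_r\}\subset A$ is called functionally independent if no nonzero polynomial in $r$ variables with coefficients in $K$ vanishes at $(\phi_1,\dots,\phi_r)$ (functional independence in $A$ is the same as algebraic independence over $K$); otherwise it is functionally dependent. $A$ is also assumed to carry a partial order $\le$ such that $\psi_1>\psi_2$ and $\varphi_1\ge\varphi_2$ imply $\psi_1+\varphi_1>\psi_2+\varphi_2$, and $\psi^2\ge 0$ for all $\psi\in A$. $\partial_1,\dots,\partial_n$ are the $K$-linear derivations $A\to A$ determined by $\partial_i x_j=\delta_{ij}$, and $\nabla\phi=(\partial_1\phi,\dots,\partial_n\phi)\in A^n$. *)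

theory Defs
  imports
    "HOL-Algebra.Generated_Fields"
    "HOL-Library.Poly_Mapping"
    "Jordan_Normal_Form.DL_Rank"
begin

definition prime_subfield :: "'a::field_char_0 set" where
  "prime_subfield = generate_field class_ring {1}"

lemma prime_subfield_eq_Rats: "(prime_subfield :: 'a::field_char_0 set) = \<rat>"
proof -
  let ?R = "class_ring :: 'a ring"
  have minus: "\<ominus>\<^bsub>?R\<^esub> x = - x" for x :: 'a
    by (simp add: class_ring_simps)
  have inverse: "inv\<^bsub>?R\<^esub> x = inverse x" if "x \<noteq> 0" for x :: 'a
    using that by (simp add: class_ring_simps)
  have "x \<in> \<rat>" if "x \<in> generate_field ?R {1}" for x
    using that by induction (auto simp: minus inverse)
  moreover have "x \<in> generate_field ?R {1}" if "x \<in> \<rat>" for x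
  proof -
    have nat: "of_nat k \<in> generate_field ?R {1}" for k
    proof (induction k)
      case 0
      have "1 + (- 1) \<in> generate_field ?R {1}"
        using generate_field.eng_add[OF generate_field.one generate_field.a_inv[OF generate_field.one],
            of ?R "{1}"] by (simp add: minus)
      then show ?case by simp
    next
      case (Suc k)
      then show ?case
        using generate_field.eng_add[OF generate_field.one Suc.IH] by simp
    qed
    have int: "of_int k \<in> generate_field ?R {1}" for k
    proof (cases k)
      case (nonneg m)
      then show ?thesis using nat by simp
    next
      case (neg m)
      then show ?thesis
        using generate_field.a_inv[OF nat[of "Suc m"]] by (simp add: minus)
    qed
    from that obtain a b where ab: "b > 0" "x = of_int a / of_int b"
      by (auto elim: Rats_cases')
    then have "inverse (of_int b) \<in> generate_field ?R {1}"
      using generate_field.m_inv[OF int[of b]] by (simp add: inverse)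
    from generate_field.eng_mult[OF int[of a] this] ab show ?thesis
      by (simp add: divide_inverse)
  qed
  ultimately show ?thesis by (auto simp: prime_subfield_def)
qed

text \<open>
  A polynomial in the variables \<open>X\<^sub>0, X\<^sub>1, \<dots>\<close> is a finitely supported map from monomials
  (finitely supported exponent maps) to coefficients.
\<close>

type_synonym 'a mpolynomial = "(nat \<Rightarrow>\<^sub>0 nat) \<Rightarrow>\<^sub>0 'a"

text \<open>Polynomials in \<open>X\<^sub>0, \<dots>, X\<^bsub>r-1\<^esub>\<close> with coefficients in \<open>K\<close>.\<close>

definition mpolynomials :: "'a::zero set \<Rightarrow> nat \<Rightarrow> 'a mpolynomial set" where
  "mpolynomials K r =
     {p. (\<forall>m. Poly_Mapping.lookup p m \<in> K) \<and>
        (\<forall>m\<in>Poly_Mapping.keys p. Poly_Mapping.keys m \<subseteq> {..<r})}"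

definition eval_mpolynomial :: "(nat \<Rightarrow> 'a::comm_semiring_1) \<Rightarrow> 'a mpolynomial \<Rightarrow> 'a" where
  "eval_mpolynomial \<phi> p =
     (\<Sum>m\<in>Poly_Mapping.keys p. Poly_Mapping.lookup p m *
        (\<Prod>i\<in>Poly_Mapping.keys m. \<phi> i ^ Poly_Mapping.lookup m i))"

text \<open>
  The property does not depend on the enumeration \<open>\<phi>\<close> of the finite set, because variables can be
  renamed.
\<close>

definition functionally_independent :: "'a::field_char_0 set \<Rightarrow> bool" where
  "functionally_independent \<Phi> \<longleftrightarrow> finite \<Phi> \<and>
     (\<forall>r \<phi>. bij_betw \<phi> {..<r} \<Phi> \<longrightarrow>
        \<not> (\<exists>p\<in>mpolynomials prime_subfield r. p \<noteq> 0 \<and> eval_mpolynomial \<phi> p = 0))"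

definition functionally_dependent :: "'a::field_char_0 set \<Rightarrow> bool" where
  "functionally_dependent \<Phi> \<longleftrightarrow> finite \<Phi> \<and> \<not> functionally_independent \<Phi>"

definition linear_derivation :: "'a::comm_ring_1 set \<Rightarrow> ('a \<Rightarrow> 'a) \<Rightarrow> bool" where
  "linear_derivation K d \<longleftrightarrow>
     (\<forall>a b. d (a + b) = d a + d b) \<and>
     (\<forall>c\<in>K. \<forall>a. d (c * a) = c * d a) \<and>
     (\<forall>a b. d (a * b) = d a * b + a * d b)"

definition gradient :: "nat \<Rightarrow> (nat \<Rightarrow> 'a \<Rightarrow> 'a) \<Rightarrow> 'a \<Rightarrow> 'a vec" where
  "gradient n D \<phi> = vec n (\<lambda>i. D i \<phi>)"

text \<open>
  A family \<open>v\<^sub>0, \<dots>, v\<^bsub>r-1\<^esub>\<close> in \<open>A\<^sup>n\<close> is linearly independent if its members are distinct and form a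
  linearly independent set.
\<close>

definition lin_indpt_family :: "nat \<Rightarrow> nat \<Rightarrow> (nat \<Rightarrow> 'a::field vec) \<Rightarrow> bool" where
  "lin_indpt_family n r v \<longleftrightarrow>
     inj_on v {..<r} \<and> \<not> module.lin_dep class_ring (module_vec TYPE('a) n) (v ` {..<r})"

end

theory Submission
  imports Defs
begin

text \<open>
  Fix an enumeration \<open>\<phi>\<^sub>0, \<dots>, \<phi>\<^bsub>r-1\<^esub>\<close>. The criterion compares polynomial relations over \<open>\<rat>\<close> between
  the \<open>\<phi>\<^sub>j\<close> with linear relations over the field between their gradients.

  If some nonzero polynomial vanishes at \<open>\<phi>\<close>, take one of least total degree. Applying each \<open>\<partial>\<^sub>k\<close> and the
  chain rule gives a linear relation between the gradients whose coefficients are the values of the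
  partial derivatives of the polynomial. Nonzero partial derivatives have smaller degree, so they do
  not vanish at \<open>\<phi>\<close>, and in characteristic 0 not all of them are zero: the gradients are dependent
  (\<open>independent_family_if_gradients_independent\<close>).

  An independent family has at most \<open>n\<close> members (\<open>independent_family_length_le\<close>), by counting
  dimensions over \<open>\<rat>\<close>. With a common denominator \<open>b\<close>, the monomials in the \<open>\<phi>\<^sub>j\<close> with exponents at
  most \<open>N\<close>, multiplied by \<open>b\<^bsup>rN\<^esup>\<close>, are polynomials in the generators with exponents \<open>O(N)\<close>. There are
  \<open>(N + 1)\<^sup>r\<close> of them in a space of dimension \<open>O(N\<^sup>n)\<close>, so independence forces \<open>r \<le> n\<close>.

  Hence an independent family extends to one of maximal length \<open>m \<le> n\<close>. By maximality every generator
  \<open>x\<^sub>i\<close> satisfies a polynomial relation with the members of the extended family, and differentiating a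
  minimal one expresses \<open>\<nabla>x\<^sub>i\<close>, the \<open>i\<close>-th unit vector, as a combination of their gradients
  (\<open>gradient_combination\<close>). So \<open>m \<le> n\<close> gradients span the space of dimension \<open>n\<close>, and are therefore linearly
  independent. The gradients of the given family are among them
  (\<open>gradients_independent_if_independent_family\<close>).

  The linear independence of the gradients does not depend on the enumeration, so the criterion for
  families yields the one for sets without renaming variables in polynomials.
\<close>

section \<open>Relations and monomials\<close>

text \<open>
  The value at \<open>\<phi>\<close> of the monomial with exponents \<open>m\<close>.
\<close>

definition monomial_value :: "(nat \<Rightarrow> 'a::comm_semiring_1) \<Rightarrow> (nat \<Rightarrow>\<^sub>0 nat) \<Rightarrow> 'a" where
  "monomial_value \<phi> m = (\<Prod>i\<in>Poly_Mapping.keys m. \<phi> i ^ Poly_Mapping.lookup m i)"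

text \<open>
  Algebraic independence over \<open>\<rat>\<close> of the family \<open>\<phi>\<^sub>0, \<dots>, \<phi>\<^bsub>r-1\<^esub>\<close>; the values of \<open>\<phi>\<close> from \<open>r\<close> on are
  irrelevant. In contrast to the notion for sets, the enumeration is fixed.
\<close>

definition independent_family :: "nat \<Rightarrow> (nat \<Rightarrow> 'a::field_char_0) \<Rightarrow> bool" where
  "independent_family r \<phi> \<longleftrightarrow> (\<forall>p\<in>mpolynomials \<rat> r. p \<noteq> 0 \<longrightarrow> eval_mpolynomial \<phi> p \<noteq> 0)"

lemma eval_mpolynomial_altdef:
  "eval_mpolynomial \<phi> p =
     (\<Sum>m\<in>Poly_Mapping.keys p. Poly_Mapping.lookup p m * monomial_value \<phi> m)"
  by (simp add: eval_mpolynomial_def monomial_value_def)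

lemma eval_mpolynomial_single [simp]:
  "eval_mpolynomial \<phi> (Poly_Mapping.single m c) = c * monomial_value \<phi> m"
  by (cases "c = 0") (simp_all add: eval_mpolynomial_altdef)

lemma eval_mpolynomial_zero [simp]: "eval_mpolynomial \<phi> 0 = 0"
  by (simp add: eval_mpolynomial_altdef)

lemma eval_mpolynomial_add:
  "eval_mpolynomial \<phi> (p + q) = eval_mpolynomial \<phi> p + eval_mpolynomial \<phi> q"
  unfolding eval_mpolynomial_altdef
  by (rule setsum_keys_plus_distrib) (simp_all add: algebra_simps)

lemma eval_mpolynomial_sum:
  "eval_mpolynomial \<phi> (\<Sum>i\<in>I. f i) = (\<Sum>i\<in>I. eval_mpolynomial \<phi> (f i))"
  by (induction I rule: infinite_finite_induct) (simp_all add: eval_mpolynomial_add)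

lemma eval_mpolynomial_cong:
  assumes "p \<in> mpolynomials K r" "\<And>i. i < r \<Longrightarrow> \<phi> i = \<psi> i"
  shows "eval_mpolynomial \<phi> p = eval_mpolynomial \<psi> p"
  unfolding eval_mpolynomial_def
  using assms by (intro sum.cong refl arg_cong2[where f = "(*)"] prod.cong)
    (auto simp: mpolynomials_def subset_iff)

lemma monomial_value_eq_prod:
  assumes "Poly_Mapping.keys m \<subseteq> {..<r}"
  shows "monomial_value \<phi> m = (\<Prod>i<r. \<phi> i ^ Poly_Mapping.lookup m i)"
  unfolding monomial_value_def
  using assms by (intro prod.mono_neutral_left) (auto simp: in_keys_iff)

text \<open>
  The form of independence used for counting: distinct monomials are linearly independent over \<open>\<rat>\<close>.
  Exponents are given by functions, which must be extensional because only their values below \<open>r\<close>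
  count.
\<close>

lemma independent_family_linear_independence:
  fixes u :: "(nat \<Rightarrow> nat) \<Rightarrow> rat"
  assumes ind: "independent_family r \<phi>"
    and fin: "finite B" and B: "B \<subseteq> extensional {..<r}"
    and rel: "(\<Sum>m\<in>B. of_rat (u m) * (\<Prod>i<r. \<phi> i ^ m i)) = 0"
    and m: "m \<in> B"
  shows "u m = 0"
proof -
  define E where "E m = Abs_poly_mapping (\<lambda>i. if i < r then m i else (0::nat))" for m :: "nat \<Rightarrow> nat"
  have lookup_E: "Poly_Mapping.lookup (E m) i = (if i < r then m i else 0)" for m i
    unfolding E_def by (subst lookup_Abs_poly_mapping) (auto intro: finite_subset[of _ "{..<r}"])
  have keys_E: "Poly_Mapping.keys (E m) \<subseteq> {..<r}" for m
    by (auto simp: in_keys_iff lookup_E split: if_splits)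
  have inj: "E k = E m \<longleftrightarrow> k = m" if "k \<in> B" "m \<in> B" for k m
  proof
    assume eq: "E k = E m"
    show "k = m"
    proof (rule extensionalityI[of _ "{..<r}"])
      show "k \<in> extensional {..<r}" "m \<in> extensional {..<r}" using that B by auto
      show "k i = m i" if "i \<in> {..<r}" for i
        using lookup_E[of k i] lookup_E[of m i] eq that by simp
    qed
  qed simp
  define p :: "'a mpolynomial" where "p = (\<Sum>m\<in>B. Poly_Mapping.single (E m) (of_rat (u m)))"
  have lookup_p: "Poly_Mapping.lookup p e = (\<Sum>m\<in>B. of_rat (u m) when E m = e)" for e
    by (simp add: p_def lookup_sum lookup_single)
  have "p \<in> mpolynomials \<rat> r"
    unfolding mpolynomials_def
  proof (intro CollectI conjI allI ballI)
    show "Poly_Mapping.lookup p e \<in> \<rat>" for e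
      unfolding lookup_p
      by (induction B rule: infinite_finite_induct) (auto simp: when_def)
    show "Poly_Mapping.keys e \<subseteq> {..<r}" if "e \<in> Poly_Mapping.keys p" for e
    proof -
      from that have "(\<Sum>m\<in>B. (of_rat (u m) :: 'a) when E m = e) \<noteq> 0"
        by (simp add: in_keys_iff lookup_p)
      then obtain m where "E m = e"
        by (metis (mono_tags, lifting) sum.neutral when_def)
      then show ?thesis using keys_E by auto
    qed
  qed
  moreover have "eval_mpolynomial \<phi> p = 0"
    using rel by (simp add: p_def eval_mpolynomial_sum monomial_value_eq_prod[OF keys_E] lookup_E)
  ultimately have "p = 0"
    using ind by (auto simp: independent_family_def)
  then have "0 = (\<Sum>k\<in>B. (of_rat (u k) :: 'a) when E k = E m)"
    using lookup_p[of "E m"] by simp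
  also have "\<dots> = (\<Sum>k\<in>B. (of_rat (u k) :: 'a) when k = m)"
    using m inj by (intro sum.cong) auto
  also have "\<dots> = of_rat (u m)"
    using fin m by (simp add: when_def)
  finally show ?thesis by simp
qed

section \<open>Partial derivatives and minimal relations\<close>

text \<open>
  The formal partial derivative with respect to \<open>X\<^sub>j\<close>. For a monomial that does not contain \<open>X\<^sub>j\<close>, the
  truncated difference of exponents is meaningless, but the coefficient is 0.
\<close>

definition partial_derivative :: "nat \<Rightarrow> 'a::comm_semiring_1 mpolynomial \<Rightarrow> 'a mpolynomial" where
  "partial_derivative j p =
     (\<Sum>m\<in>Poly_Mapping.keys p. Poly_Mapping.single (m - Poly_Mapping.single j 1)
        (of_nat (Poly_Mapping.lookup m j) * Poly_Mapping.lookup p m))"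

lemma lookup_partial_derivative:
  "Poly_Mapping.lookup (partial_derivative j p) m =
     of_nat (Suc (Poly_Mapping.lookup m j)) * Poly_Mapping.lookup p (m + Poly_Mapping.single j 1)"
proof -
  let ?e = "Poly_Mapping.single j (1::nat)"
  have "((of_nat (Poly_Mapping.lookup k j) * Poly_Mapping.lookup p k) when k - ?e = m) =
      (if k = m + ?e then of_nat (Suc (Poly_Mapping.lookup m j)) * Poly_Mapping.lookup p (m + ?e) else 0)" for k
  proof (cases "Poly_Mapping.lookup k j = 0")
    case True
    then have "k \<noteq> m + ?e" by (auto simp: lookup_add)
    with True show ?thesis by simp
  next
    case False
    then have "k - ?e + ?e = k"
      by (intro poly_mapping_eqI) (auto simp: lookup_add lookup_minus lookup_single when_def)
    then have "k - ?e = m \<longleftrightarrow> k = m + ?e" by (metis add_diff_cancel_right')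
    then show ?thesis by (auto simp: lookup_add)
  qed
  then have "Poly_Mapping.lookup (partial_derivative j p) m =
      (\<Sum>k\<in>Poly_Mapping.keys p. if k = m + ?e
         then of_nat (Suc (Poly_Mapping.lookup m j)) * Poly_Mapping.lookup p (m + ?e) else 0)"
    by (simp add: partial_derivative_def lookup_sum lookup_single)
  then show ?thesis
    by (simp add: in_keys_iff)
qed

lemma partial_derivative_in_mpolynomials:
  assumes "p \<in> mpolynomials \<rat> r"
  shows "partial_derivative j (p :: 'a::field_char_0 mpolynomial) \<in> mpolynomials \<rat> r"
  unfolding mpolynomials_def
proof (intro CollectI conjI allI ballI)
  show "Poly_Mapping.lookup (partial_derivative j p) m \<in> \<rat>" for m
    unfolding lookup_partial_derivative
    using assms by (intro Rats_mult Rats_of_nat) (auto simp: mpolynomials_def)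
  fix m assume "m \<in> Poly_Mapping.keys (partial_derivative j p)"
  then have "m + Poly_Mapping.single j 1 \<in> Poly_Mapping.keys p"
    unfolding in_keys_iff lookup_partial_derivative by auto
  then have "Poly_Mapping.keys (m + Poly_Mapping.single j 1) \<subseteq> {..<r}"
    using assms by (auto simp: mpolynomials_def)
  then show "Poly_Mapping.keys m \<subseteq> {..<r}"
    by (auto simp: in_keys_iff lookup_add subset_iff)
qed

lemma linear_derivation_one: "linear_derivation K d \<Longrightarrow> d 1 = 0"
  unfolding linear_derivation_def by (metis add_cancel_right_right mult_1 mult.right_neutral)

lemma linear_derivation_zero: "linear_derivation K d \<Longrightarrow> d 0 = 0"
  unfolding linear_derivation_def by (metis add_cancel_right_right add.right_neutral)

lemma linear_derivation_sum:
  assumes "linear_derivation K d"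
  shows "d (\<Sum>i\<in>I. f i) = (\<Sum>i\<in>I. d (f i))"
proof -
  have add: "d (a + b) = d a + d b" for a b
    using assms unfolding linear_derivation_def by blast
  show ?thesis
    by (induction I rule: infinite_finite_induct) (simp_all add: linear_derivation_zero[OF assms] add)
qed

lemma linear_derivation_power:
  assumes "linear_derivation K d"
  shows "d (a ^ k) = of_nat k * a ^ (k - 1) * d a"
proof (induction k)
  case 0
  then show ?case using linear_derivation_one[OF assms] by simp
next
  case (Suc k)
  have "d (a ^ Suc k) = d a * a ^ k + a * d (a ^ k)"
    using assms by (simp add: linear_derivation_def)
  with Suc show ?case by (cases k) (simp_all add: algebra_simps)
qed

lemma linear_derivation_prod:
  assumes "linear_derivation K d" "finite I"
  shows "d (\<Prod>i\<in>I. f i) = (\<Sum>j\<in>I. d (f j) * (\<Prod>i\<in>I - {j}. f i))"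
  using assms(2)
proof induction
  case empty
  then show ?case using linear_derivation_one[OF assms(1)] by simp
next
  case (insert k I)
  have "d (\<Prod>i\<in>insert k I. f i) = d (f k) * (\<Prod>i\<in>I. f i) + f k * d (\<Prod>i\<in>I. f i)"
    using insert.hyps assms(1) by (simp add: linear_derivation_def)
  also have "f k * d (\<Prod>i\<in>I. f i) = (\<Sum>j\<in>I. d (f j) * (\<Prod>i\<in>insert k I - {j}. f i))"
    unfolding insert.IH sum_distrib_left
  proof (rule sum.cong)
    fix j assume "j \<in> I"
    with insert.hyps have "insert k I - {j} = insert k (I - {j})" by auto
    with insert.hyps show "f k * (d (f j) * prod f (I - {j})) = d (f j) * prod f (insert k I - {j})"
      by (simp add: mult_ac)
  qed simp
  finally show ?case using insert.hyps by simp
qed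

lemma linear_derivation_monomial_value:
  assumes d: "linear_derivation K d" and m: "Poly_Mapping.keys m \<subseteq> {..<r}"
  shows "d (monomial_value \<phi> m) =
    (\<Sum>j<r. of_nat (Poly_Mapping.lookup m j) *
       monomial_value \<phi> (m - Poly_Mapping.single j 1) * d (\<phi> j))"
proof -
  have "d (monomial_value \<phi> m) = (\<Sum>j<r. d (\<phi> j ^ Poly_Mapping.lookup m j) *
      (\<Prod>i\<in>{..<r} - {j}. \<phi> i ^ Poly_Mapping.lookup m i))"
    by (simp add: monomial_value_eq_prod[OF m] linear_derivation_prod[OF d])
  also have "\<dots> = (\<Sum>j<r. of_nat (Poly_Mapping.lookup m j) *
       monomial_value \<phi> (m - Poly_Mapping.single j 1) * d (\<phi> j))"
  proof (rule sum.cong)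
    fix j assume j: "j \<in> {..<r}"
    let ?m = "m - Poly_Mapping.single j 1"
    have "Poly_Mapping.keys ?m \<subseteq> {..<r}"
      using m by (auto simp: in_keys_iff lookup_minus subset_iff)
    then have "monomial_value \<phi> ?m = (\<Prod>i<r. \<phi> i ^ Poly_Mapping.lookup ?m i)"
      by (rule monomial_value_eq_prod)
    also have "\<dots> = \<phi> j ^ (Poly_Mapping.lookup m j - 1) *
        (\<Prod>i\<in>{..<r} - {j}. \<phi> i ^ Poly_Mapping.lookup ?m i)"
      using j by (subst prod.remove[of _ j]) (auto simp: lookup_minus)
    also have "(\<Prod>i\<in>{..<r} - {j}. \<phi> i ^ Poly_Mapping.lookup ?m i) =
        (\<Prod>i\<in>{..<r} - {j}. \<phi> i ^ Poly_Mapping.lookup m i)"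
      by (intro prod.cong) (auto simp: lookup_minus lookup_single)
    finally show "d (\<phi> j ^ Poly_Mapping.lookup m j) *
        (\<Prod>i\<in>{..<r} - {j}. \<phi> i ^ Poly_Mapping.lookup m i) =
        of_nat (Poly_Mapping.lookup m j) * monomial_value \<phi> ?m * d (\<phi> j)"
      by (simp add: linear_derivation_power[OF d] mult_ac)
  qed simp
  finally show ?thesis .
qed

lemma chain_rule:
  assumes d: "linear_derivation K d" and p: "p \<in> mpolynomials K r"
  shows "d (eval_mpolynomial \<phi> p) =
    (\<Sum>j<r. eval_mpolynomial \<phi> (partial_derivative j p) * d (\<phi> j))"
proof -
  have "d (eval_mpolynomial \<phi> p) =
      (\<Sum>m\<in>Poly_Mapping.keys p. Poly_Mapping.lookup p m * d (monomial_value \<phi> m))"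
    using d p unfolding eval_mpolynomial_altdef linear_derivation_sum[OF d]
    by (intro sum.cong) (auto simp: linear_derivation_def mpolynomials_def)
  also have "\<dots> = (\<Sum>m\<in>Poly_Mapping.keys p. \<Sum>j<r. Poly_Mapping.lookup p m *
      (of_nat (Poly_Mapping.lookup m j) *
       monomial_value \<phi> (m - Poly_Mapping.single j 1) * d (\<phi> j)))"
    using p unfolding mpolynomials_def
    by (intro sum.cong refl) (simp add: linear_derivation_monomial_value[OF d, of _ r] sum_distrib_left)
  also have "\<dots> = (\<Sum>j<r. eval_mpolynomial \<phi> (partial_derivative j p) * d (\<phi> j))"
    by (subst sum.swap)
      (simp add: partial_derivative_def eval_mpolynomial_sum sum_distrib_left mult_ac)
  finally show ?thesis .
qed

text \<open>
  A relation of least total degree: a nonzero partial derivative has smaller degree, so it cannot be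
  a relation itself.
\<close>

lemma minimal_relation:
  assumes "\<not> independent_family r \<phi>"
  obtains p where "p \<in> mpolynomials \<rat> r" "p \<noteq> 0" "eval_mpolynomial \<phi> p = 0"
    "\<And>j. partial_derivative j p \<noteq> 0 \<Longrightarrow> eval_mpolynomial \<phi> (partial_derivative j p) \<noteq> 0"
proof -
  define deg where "deg m = (\<Sum>i<r. Poly_Mapping.lookup m i)" for m :: "nat \<Rightarrow>\<^sub>0 nat"
  define R where "R k \<longleftrightarrow> (\<exists>p\<in>mpolynomials \<rat> r. p \<noteq> 0 \<and> eval_mpolynomial \<phi> p = 0 \<and>
      (\<forall>m\<in>Poly_Mapping.keys p. deg m \<le> k))" for k
  from assms obtain p where p: "p \<in> mpolynomials \<rat> r" "p \<noteq> 0" "eval_mpolynomial \<phi> p = 0"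
    by (auto simp: independent_family_def)
  have "R (Max (deg ` Poly_Mapping.keys p))"
    unfolding R_def using p by (intro bexI[of _ p]) auto
  then have "R (LEAST k. R k)" by (rule LeastI)
  then obtain q where q: "q \<in> mpolynomials \<rat> r" "q \<noteq> 0" "eval_mpolynomial \<phi> q = 0"
    and deg_q: "\<forall>m\<in>Poly_Mapping.keys q. deg m \<le> (LEAST k. R k)"
    unfolding R_def by blast
  have "eval_mpolynomial \<phi> (partial_derivative j q) \<noteq> 0" if nz: "partial_derivative j q \<noteq> 0" for j
  proof
    assume zero: "eval_mpolynomial \<phi> (partial_derivative j q) = 0"
    have deg_pd: "deg m < (LEAST k. R k)" if "m \<in> Poly_Mapping.keys (partial_derivative j q)" for m
    proof -
      let ?m = "m + Poly_Mapping.single j 1"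
      have m: "?m \<in> Poly_Mapping.keys q"
        using that unfolding in_keys_iff lookup_partial_derivative by auto
      then have "Poly_Mapping.keys ?m \<subseteq> {..<r}"
        using q(1) by (auto simp: mpolynomials_def)
      then have "j < r"
        by (auto simp: in_keys_iff lookup_add subset_iff)
      then have "deg ?m = Suc (deg m)"
        by (simp add: deg_def lookup_add lookup_single sum.distrib when_def)
      with deg_q m show ?thesis by fastforce
    qed
    from nz obtain m where "m \<in> Poly_Mapping.keys (partial_derivative j q)"
      by (metis ex_in_conv keys_eq_empty)
    from deg_pd[OF this] have "(LEAST k. R k) - 1 < (LEAST k. R k)" by simp
    moreover have "\<forall>m\<in>Poly_Mapping.keys (partial_derivative j q). deg m \<le> (LEAST k. R k) - 1"
      using deg_pd by fastforce
    then have "R ((LEAST k. R k) - 1)"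
      using zero nz partial_derivative_in_mpolynomials[OF q(1)] unfolding R_def[of "_ - 1"]
      by blast
    ultimately show False using not_less_Least by blast
  qed
  with q that show thesis by blast
qed

text \<open>
  In characteristic 0, only a polynomial that does not contain \<open>X\<^sub>j\<close> has zero derivative by \<open>X\<^sub>j\<close>.
\<close>

lemma lookup_zero_if_partial_derivative_zero:
  assumes "partial_derivative j (p :: 'a::field_char_0 mpolynomial) = 0"
    and "Poly_Mapping.lookup m j \<noteq> 0"
  shows "Poly_Mapping.lookup p m = 0"
proof -
  let ?m = "m - Poly_Mapping.single j 1"
  have "?m + Poly_Mapping.single j 1 = m"
    using assms(2) by (intro poly_mapping_eqI) (auto simp: lookup_add lookup_minus lookup_single when_def)
  then show ?thesis
    using lookup_partial_derivative[of j p ?m] assms(1) 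
    by (auto simp del: of_nat_Suc)
qed

text \<open>
  Linear independence of the gradients implies algebraic independence: the derivations turn a minimal
  relation between the \<open>\<phi>\<^sub>j\<close> into a linear relation between their gradients.
\<close>

lemma independent_family_if_gradients_independent:
  fixes \<phi> :: "nat \<Rightarrow> 'a::field_char_0"
  assumes der: "\<And>k. k < n \<Longrightarrow> linear_derivation \<rat> (D k)"
    and indep: "\<And>c. (\<And>k. k < n \<Longrightarrow> (\<Sum>j<r. c j * D k (\<phi> j)) = 0) \<Longrightarrow> \<forall>j<r. c j = 0"
  shows "independent_family r \<phi>"
proof (rule ccontr)
  assume "\<not> independent_family r \<phi>"
  then obtain p where p: "p \<in> mpolynomials \<rat> r" "p \<noteq> 0" "eval_mpolynomial \<phi> p = 0"
    and min: "\<And>j. partial_derivative j p \<noteq> 0 \<Longrightarrow>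
      eval_mpolynomial \<phi> (partial_derivative j p) \<noteq> 0"
    by (rule minimal_relation) blast
  have "\<forall>j<r. eval_mpolynomial \<phi> (partial_derivative j p) = 0"
  proof (rule indep)
    show "(\<Sum>j<r. eval_mpolynomial \<phi> (partial_derivative j p) * D k (\<phi> j)) = 0" if "k < n" for k
      using chain_rule[OF der[OF that] p(1), of \<phi>] linear_derivation_zero[OF der[OF that]] p(3)
      by simp
  qed
  with min have pd: "partial_derivative j p = 0" if "j < r" for j
    using that by blast
  \<comment> \<open>All partial derivatives vanish, so \<open>p\<close> is a nonzero constant, which has no zeros.\<close>
  have "m = 0" if m: "m \<in> Poly_Mapping.keys p" for m
  proof (rule poly_mapping_eqI)
    fix i
    have "i < r" if "Poly_Mapping.lookup m i \<noteq> 0"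
      using p(1) m that by (auto simp: mpolynomials_def in_keys_iff subset_iff)
    then have "Poly_Mapping.lookup m i = 0"
      using lookup_zero_if_partial_derivative_zero[OF pd, of i m] m by (auto simp: in_keys_iff)
    then show "Poly_Mapping.lookup m i = Poly_Mapping.lookup 0 i" by simp
  qed
  with p(2) have keys: "Poly_Mapping.keys p = {0}"
    by (metis all_not_in_conv keys_eq_empty singleton_iff subsetI subset_singletonD)
  then have "eval_mpolynomial \<phi> p = Poly_Mapping.lookup p 0"
    by (simp add: eval_mpolynomial_def)
  with p(3) keys show False
    by (metis in_keys_iff singletonI)
qed

section \<open>At most \<open>n\<close> independent elements\<close>

text \<open>
  The field as a vector space over \<open>\<rat>\<close>.
\<close>

interpretation rat_space: vector_space "\<lambda>(q::rat) (a::'a::field_char_0). of_rat q * a"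
  by unfold_locales (simp_all add: algebra_simps of_rat_add of_rat_mult)

text \<open>
  The values at \<open>x\<^sub>0, \<dots>, x\<^bsub>n-1\<^esub>\<close> of the rational polynomials of degree at most \<open>d\<close> in each variable.
  Bounding the degrees separately makes the monomials easy to count.
\<close>

definition polynomial_box :: "nat \<Rightarrow> (nat \<Rightarrow> 'a::field_char_0) \<Rightarrow> nat \<Rightarrow> 'a set" where
  "polynomial_box n x d =
     rat_space.span ((\<lambda>m. \<Prod>i<n. x i ^ m i) ` (PiE {..<n} (\<lambda>_. {..d})))"

lemma polynomial_box_monomial:
  assumes "\<And>i. i < n \<Longrightarrow> m i \<le> d"
  shows "(\<Prod>i<n. x i ^ m i) \<in> polynomial_box n x d"
  unfolding polynomial_box_def
  using assms by (intro rat_space.span_base image_eqI[of _ _ "restrict m {..<n}"]) auto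

lemma polynomial_box_add:
  "a \<in> polynomial_box n x d \<Longrightarrow> b \<in> polynomial_box n x d \<Longrightarrow> a + b \<in> polynomial_box n x d"
  unfolding polynomial_box_def by (rule rat_space.span_add)

lemma polynomial_box_uminus: "a \<in> polynomial_box n x d \<Longrightarrow> - a \<in> polynomial_box n x d"
  unfolding polynomial_box_def by (rule rat_space.span_neg)

lemma polynomial_box_one: "1 \<in> polynomial_box n x d"
  using polynomial_box_monomial[of n "\<lambda>_. 0" d x] by simp

lemma polynomial_box_generator:
  assumes "i < n"
  shows "x i \<in> polynomial_box n x 1"
proof -
  have "(\<Prod>k<n. x k ^ (if k = i then 1 else 0)) = (\<Prod>k<n. if k = i then x i else 1)"
    by (intro prod.cong) auto
  also have "\<dots> = x i" using assms by simp
  finally show ?thesis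
    using polynomial_box_monomial[of n "\<lambda>k. if k = i then 1 else 0" 1 x] by simp
qed

lemma polynomial_box_mult:
  assumes a: "a \<in> polynomial_box n x d" and b: "b \<in> polynomial_box n x e"
  shows "a * b \<in> polynomial_box n x (d + e)"
proof -
  note sub [simp] = rat_space.span_zero rat_space.span_add rat_space.span_scale
  have mono: "(\<Prod>i<n. x i ^ m i) * b \<in> polynomial_box n x (d + e)"
    if m: "m \<in> PiE {..<n} (\<lambda>_. {..d})" for m
    using b unfolding polynomial_box_def[of n x e]
  proof (induction rule: rat_space.span_induct_alt)
    case base
    then show ?case by (simp add: polynomial_box_def)
  next
    case (step c y z)
    then obtain k where k: "k \<in> PiE {..<n} (\<lambda>_. {..e})" "y = (\<Prod>i<n. x i ^ k i)" by auto
    have "(\<Prod>i<n. x i ^ m i) * y = (\<Prod>i<n. x i ^ (m i + k i))"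
      by (simp add: k(2) prod.distrib power_add)
    also have "\<dots> \<in> polynomial_box n x (d + e)"
      using m k(1) by (intro polynomial_box_monomial add_mono) (auto simp: PiE_iff)
    finally have "of_rat c * ((\<Prod>i<n. x i ^ m i) * y) + (\<Prod>i<n. x i ^ m i) * z
        \<in> polynomial_box n x (d + e)"
      using step(2) by (simp add: polynomial_box_def)
    then show ?case by (simp add: algebra_simps)
  qed
  show ?thesis
    using a unfolding polynomial_box_def[of n x d]
  proof (induction rule: rat_space.span_induct_alt)
    case base
    then show ?case by (simp add: polynomial_box_def)
  next
    case (step c y z)
    then have "of_rat c * (y * b) + z * b \<in> polynomial_box n x (d + e)"
      using mono by (auto simp: polynomial_box_def)
    then show ?case by (simp add: algebra_simps)
  qed
qed

lemma polynomial_box_power: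
  "a \<in> polynomial_box n x d \<Longrightarrow> a ^ k \<in> polynomial_box n x (k * d)"
  by (induction k) (simp_all add: polynomial_box_one polynomial_box_mult)

lemma polynomial_box_prod:
  assumes "\<And>j. j < (r::nat) \<Longrightarrow> f j \<in> polynomial_box n x d"
  shows "(\<Prod>j<r. f j) \<in> polynomial_box n x (r * d)"
  using assms
proof (induction r)
  case (Suc r)
  then have "(\<Prod>j<r. f j) * f r \<in> polynomial_box n x (r * d + d)"
    by (intro polynomial_box_mult) auto
  then show ?case by (simp add: add.commute)
qed (simp add: polynomial_box_one)

text \<open>
  Every element of the generated field is a quotient of two polynomials in the generators; \<open>b\<close> is the
  denominator.
\<close>

lemma generate_field_quotient:
  fixes x :: "nat \<Rightarrow> 'a::field_char_0"
  assumes "a \<in> generate_field class_ring (x ` {..<n})"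
  shows "\<exists>d b. b \<noteq> 0 \<and> b \<in> polynomial_box n x d \<and> b * a \<in> polynomial_box n x d"
  using assms
proof induction
  case one
  show ?case
    by (intro exI[of _ 0] exI[of _ 1]) (simp add: polynomial_box_one)
next
  case (incl h)
  then show ?case
    by (intro exI[of _ 1] exI[of _ 1])
      (auto simp del: One_nat_def simp: polynomial_box_one intro: polynomial_box_generator)
next
  case (a_inv h)
  have "\<ominus>\<^bsub>class_ring\<^esub> h = - h" by (simp add: class_ring_simps)
  moreover from a_inv.IH obtain d b where
    "b \<noteq> 0" "b \<in> polynomial_box n x d" "b * h \<in> polynomial_box n x d" by blast
  ultimately show ?case
    by (intro exI[of _ d] exI[of _ b]) (simp add: polynomial_box_uminus)
next
  case (m_inv h)
  then have h: "h \<noteq> 0" "inv\<^bsub>class_ring\<^esub> h = inverse h" by (simp_all add: class_ring_simps)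
  from m_inv.IH obtain d b where
    "b \<noteq> 0" "b \<in> polynomial_box n x d" "b * h \<in> polynomial_box n x d" by blast
  with h show ?case
    by (intro exI[of _ d] exI[of _ "b * h"]) (simp add: mult.assoc)
next
  case (eng_add h1 h2)
  then obtain d1 b1 d2 b2 where b:
    "b1 \<noteq> 0" "b1 \<in> polynomial_box n x d1" "b1 * h1 \<in> polynomial_box n x d1"
    "b2 \<noteq> 0" "b2 \<in> polynomial_box n x d2" "b2 * h2 \<in> polynomial_box n x d2" by blast
  from b have "(b1 * h1) * b2 + b1 * (b2 * h2) \<in> polynomial_box n x (d1 + d2)"
    by (intro polynomial_box_add polynomial_box_mult)
  with b show ?case
    by (intro exI[of _ "d1 + d2"] exI[of _ "b1 * b2"])
      (simp add: polynomial_box_mult distrib_left mult_ac)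
next
  case (eng_mult h1 h2)
  then obtain d1 b1 d2 b2 where b:
    "b1 \<noteq> 0" "b1 \<in> polynomial_box n x d1" "b1 * h1 \<in> polynomial_box n x d1"
    "b2 \<noteq> 0" "b2 \<in> polynomial_box n x d2" "b2 * h2 \<in> polynomial_box n x d2" by blast
  from b have "(b1 * h1) * (b2 * h2) \<in> polynomial_box n x (d1 + d2)"
    by (intro polynomial_box_mult)
  with b show ?case
    by (intro exI[of _ "d1 + d2"] exI[of _ "b1 * b2"])
      (simp add: polynomial_box_mult mult_ac)
qed

lemma common_denominator:
  fixes x \<phi> :: "nat \<Rightarrow> 'a::field_char_0"
  assumes gen: "generate_field class_ring (x ` {..<n}) = UNIV"
  shows "\<exists>d b. b \<noteq> 0 \<and> b \<in> polynomial_box n x d \<and> (\<forall>j<r. b * \<phi> j \<in> polynomial_box n x d)"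
proof (induction r)
  case 0
  show ?case by (intro exI[of _ 0] exI[of _ 1]) (simp add: polynomial_box_one)
next
  case (Suc r)
  then obtain d1 b1 where b1: "b1 \<noteq> 0" "b1 \<in> polynomial_box n x d1"
    "\<And>j. j < r \<Longrightarrow> b1 * \<phi> j \<in> polynomial_box n x d1" by blast
  from gen obtain d2 b2 where b2: "b2 \<noteq> 0" "b2 \<in> polynomial_box n x d2"
    "b2 * \<phi> r \<in> polynomial_box n x d2"
    using generate_field_quotient[of "\<phi> r" x n] by auto
  have "(b1 * b2) * \<phi> j \<in> polynomial_box n x (d1 + d2)" if "j < Suc r" for j
  proof (cases "j = r")
    case True
    then show ?thesis using polynomial_box_mult[OF b1(2) b2(3)] by (simp add: mult_ac)
  next
    case False
    with that have "j < r" by simp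
    from polynomial_box_mult[OF b1(3)[OF this] b2(2)] show ?thesis by (simp add: mult_ac)
  qed
  with b1 b2 show ?case
    by (intro exI[of _ "d1 + d2"] exI[of _ "b1 * b2"]) (simp add: polynomial_box_mult)
qed

text \<open>
  The dimension count described at the beginning.
\<close>

lemma independent_family_length_le:
  fixes x \<phi> :: "nat \<Rightarrow> 'a::field_char_0"
  assumes gen: "generate_field class_ring (x ` {..<n}) = UNIV"
    and ind: "independent_family r \<phi>"
  shows "r \<le> n"
proof (rule ccontr)
  assume "\<not> r \<le> n"
  then have r: "n + 1 \<le> r" by simp
  obtain d b where b: "b \<noteq> 0" "b \<in> polynomial_box n x d"
    "\<And>j. j < r \<Longrightarrow> b * \<phi> j \<in> polynomial_box n x d"
    using common_denominator[OF gen, of r \<phi>] by blast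
  \<comment> \<open>This \<open>N\<close> gives \<open>(rdN + 1)\<^sup>n < (N + 1)\<^bsup>n+1\<^esup>\<close>.\<close>
  define N where "N = (r * d + 1) ^ n"
  define B where "B = PiE {..<r} (\<lambda>_. {..N})"
  define F where "F m = b ^ (r * N) * (\<Prod>j<r. \<phi> j ^ m j)" for m :: "nat \<Rightarrow> nat"
  let ?X = "PiE {..<n} (\<lambda>_::nat. {..r * (N * d)})"
  let ?G = "(\<lambda>m. \<Prod>i<n. x i ^ m i) ` ?X"
  have finB: "finite B" unfolding B_def by (intro finite_PiE) auto
  have ext: "B \<subseteq> extensional {..<r}" by (auto simp: B_def PiE_def)
  have relation: "u m = 0"
    if "S \<subseteq> B" "(\<Sum>m\<in>S. of_rat (u m) * F m) = 0" "m \<in> S" for S u m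
  proof -
    have "b ^ (r * N) * (\<Sum>m\<in>S. of_rat (u m) * (\<Prod>j<r. \<phi> j ^ m j)) = 0"
      using that(2) by (simp add: F_def sum_distrib_left mult_ac)
    with b(1) have "(\<Sum>m\<in>S. of_rat (u m) * (\<Prod>j<r. \<phi> j ^ m j)) = 0" by simp
    moreover have "finite S" "S \<subseteq> extensional {..<r}"
      using that(1) finB ext finite_subset by auto
    ultimately show ?thesis
      using independent_family_linear_independence[OF ind] that(3) by blast
  qed
  have inj: "inj_on F B"
  proof (rule inj_onI, rule ccontr)
    fix k m assume km: "k \<in> B" "m \<in> B" "F k = F m" "k \<noteq> m"
    define u :: "(nat \<Rightarrow> nat) \<Rightarrow> rat" where "u e = (if e = k then 1 else - 1)" for e
    have "u k = 0"
    proof (rule relation[of "{k, m}" u k])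
      show "{k, m} \<subseteq> B" "k \<in> {k, m}" using km by auto
      show "(\<Sum>e\<in>{k, m}. of_rat (u e) * F e) = 0" using km by (simp add: u_def)
    qed
    then show False by (simp add: u_def)
  qed
  have indep: "rat_space.independent (F ` B)"
  proof
    assume "rat_space.dependent (F ` B)"
    then obtain u where u: "\<exists>v\<in>F ` B. u v \<noteq> 0" "(\<Sum>v\<in>F ` B. of_rat (u v) * v) = 0"
      using rat_space.dependent_finite[of "F ` B"] finB by auto
    have "(\<Sum>m\<in>B. of_rat (u (F m)) * F m) = 0"
      using u(2) by (simp add: sum.reindex[OF inj] o_def)
    then have "\<forall>m\<in>B. u (F m) = 0" using relation[of B "\<lambda>m. u (F m)"] by blast
    with u(1) show False by auto
  qed
  have span: "F ` B \<subseteq> rat_space.span ?G"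
  proof
    fix y assume "y \<in> F ` B"
    then obtain m where m: "m \<in> B" "y = F m" by blast
    have le: "m j \<le> N" if "j < r" for j using m(1) that by (auto simp: B_def PiE_iff)
    \<comment> \<open>Of the \<open>N\<close> factors \<open>b\<close> for each \<open>j\<close>, \<open>m j\<close> clear the denominators of the power of \<open>\<phi> j\<close>.\<close>
    have "F m = (\<Prod>j<r. b ^ N * \<phi> j ^ m j)"
      by (simp add: F_def prod.distrib power_mult[symmetric] mult.commute)
    also have "\<dots> = (\<Prod>j<r. (b * \<phi> j) ^ m j * b ^ (N - m j))"
    proof (rule prod.cong)
      fix j assume "j \<in> {..<r}"
      with le have "b ^ N = b ^ m j * b ^ (N - m j)"
        by (simp flip: power_add)
      then show "b ^ N * \<phi> j ^ m j = (b * \<phi> j) ^ m j * b ^ (N - m j)"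
        by (simp add: power_mult_distrib mult_ac)
    qed simp
    also have "\<dots> \<in> polynomial_box n x (r * (N * d))"
    proof (rule polynomial_box_prod)
      fix j assume j: "j < r"
      have "(b * \<phi> j) ^ m j * b ^ (N - m j) \<in> polynomial_box n x (m j * d + (N - m j) * d)"
        using b j by (intro polynomial_box_mult polynomial_box_power)
      also have "m j * d + (N - m j) * d = N * d"
        using le[OF j] by (simp flip: add_mult_distrib)
      finally show "(b * \<phi> j) ^ m j * b ^ (N - m j) \<in> polynomial_box n x (N * d)" .
    qed
    finally show "y \<in> rat_space.span ?G" by (simp add: m(2) polynomial_box_def)
  qed
  have finX: "finite ?X" by (intro finite_PiE) auto
  have "(N + 1) ^ (n + 1) \<le> (N + 1) ^ r"
    by (rule power_increasing[OF r]) simp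
  also have "\<dots> = card (F ` B)"
    unfolding card_image[OF inj] by (simp add: B_def card_PiE)
  also have "\<dots> \<le> card ?G"
    using rat_space.independent_span_bound[OF _ indep span] finX by blast
  also have "\<dots> \<le> card ?X" by (rule card_image_le[OF finX])
  also have "\<dots> = (r * (N * d) + 1) ^ n" by (simp add: card_PiE)
  also have "\<dots> \<le> ((r * d + 1) * (N + 1)) ^ n"
    by (intro power_mono) (auto simp: algebra_simps)
  also have "\<dots> = N * (N + 1) ^ n" by (simp only: power_mult_distrib N_def)
  also have "\<dots> < (N + 1) ^ (n + 1)" by simp
  finally show False by simp
qed

section \<open>Linear independence and rank\<close>

lemma cols_gradient_mat:
  "cols (mat n r (\<lambda>(i, j). D i (\<phi> j))) = map (\<lambda>j. gradient n D (\<phi> j)) [0..<r]"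
  by (rule nth_equalityI) (auto simp: gradient_def)

lemma lin_indpt_family_iff_cols:
  fixes D :: "nat \<Rightarrow> 'a \<Rightarrow> 'a::field" and \<phi> :: "nat \<Rightarrow> 'a" and n r :: nat
  defines "M \<equiv> mat n r (\<lambda>(i, j). D i (\<phi> j))"
  shows "lin_indpt_family n r (\<lambda>j. gradient n D (\<phi> j)) \<longleftrightarrow>
    distinct (cols M) \<and> \<not> module.lin_dep class_ring (module_vec TYPE('a) n) (set (cols M))"
proof -
  have "distinct (cols M) \<longleftrightarrow> inj_on (\<lambda>j. gradient n D (\<phi> j)) {..<r}"
    by (simp add: M_def cols_gradient_mat distinct_map atLeast0LessThan)
  moreover have "set (cols M) = (\<lambda>j. gradient n D (\<phi> j)) ` {..<r}"
    by (simp add: M_def cols_gradient_mat atLeast0LessThan)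
  ultimately show ?thesis
    by (simp add: lin_indpt_family_def)
qed

text \<open>
  Full column rank also forces the columns to be distinct, as linear independence of a family requires.
\<close>

lemma lin_indpt_family_iff_rank:
  fixes D :: "nat \<Rightarrow> 'a \<Rightarrow> 'a::field" and \<phi> :: "nat \<Rightarrow> 'a"
  shows "lin_indpt_family n r (\<lambda>j. gradient n D (\<phi> j)) \<longleftrightarrow>
    vec_space.rank n (mat n r (\<lambda>(i, j). D i (\<phi> j))) = r"
proof -
  interpret vec_space "TYPE('a)" n .
  let ?M = "mat n r (\<lambda>(i, j). D i (\<phi> j))"
  have M: "?M \<in> carrier_mat n r" by simp
  have "distinct (cols ?M)" if rank: "rank ?M = r"
  proof -
    obtain S where S: "maximal S (\<lambda>T. T \<subseteq> set (cols ?M) \<and> lin_indpt T)"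
      using maximal_exists[of "\<lambda>T. T \<subseteq> set (cols ?M) \<and> lin_indpt T" "card (set (cols ?M))" "{}"]
      by (meson List.finite_set card_mono empty_iff empty_subsetI finite_lin_indpt2 rev_finite_subset)
    then have "card S \<le> card (set (cols ?M))" by (simp add: card_mono maximal_def)
    then have "length (cols ?M) \<le> card (set (cols ?M))"
      using rank rank_card_indpt[OF M S] by simp
    then show ?thesis
      by (intro card_distinct le_antisym card_length)
  qed
  then show ?thesis
    unfolding lin_indpt_family_iff_cols
    using lin_indpt_full_rank[OF M] full_rank_lin_indpt[OF M] by blast
qed

lemma lin_indpt_family_iff:
  fixes D :: "nat \<Rightarrow> 'a \<Rightarrow> 'a::field" and \<phi> :: "nat \<Rightarrow> 'a"
  shows "lin_indpt_family n r (\<lambda>j. gradient n D (\<phi> j)) \<longleftrightarrow>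
    (\<forall>c. (\<forall>k<n. (\<Sum>j<r. c j * D k (\<phi> j)) = 0) \<longrightarrow> (\<forall>j<r. c j = 0))"
    (is "?L \<longleftrightarrow> ?R")
proof -
  interpret vec_space "TYPE('a)" n .
  define M where "M = mat n r (\<lambda>(i, j). D i (\<phi> j))"
  have M: "M \<in> carrier_mat n r" by (simp add: M_def)
  have mult: "(M *\<^sub>v v) $ k = (\<Sum>j<r. v $ j * D k (\<phi> j))" if "v \<in> carrier_vec r" "k < n" for v k
    using that
    by (simp add: M_def scalar_prod_def mult.commute atLeast0LessThan[symmetric])
  show ?thesis
  proof
    assume L: ?L
    show ?R
    proof (intro allI impI, rule ccontr)
      fix c j assume rel: "\<forall>k<n. (\<Sum>j<r. c j * D k (\<phi> j)) = 0" and j: "j < r" "c j \<noteq> 0"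
      have "M *\<^sub>v vec r c = 0\<^sub>v n"
      proof (rule eq_vecI)
        fix k assume "k < dim_vec (0\<^sub>v n)"
        then have "k < n" by simp
        with rel show "(M *\<^sub>v vec r c) $ k = 0\<^sub>v n $ k"
          by (simp add: mult)
      qed (simp add: M_def)
      moreover have "vec r c \<noteq> 0\<^sub>v r" 
        using j by (metis index_vec index_zero_vec(1))
      moreover have "distinct (cols M)" "lin_indpt (set (cols M))"
        using L unfolding lin_indpt_family_iff_cols M_def by auto
      ultimately show False using lin_depI[OF M vec_carrier] by blast
    qed
  next
    assume R: ?R
    have "inj_on (\<lambda>j. gradient n D (\<phi> j)) {..<r}"
    proof (rule inj_onI, rule ccontr)
      fix i j assume ij: "i \<in> {..<r}" "j \<in> {..<r}" "i \<noteq> j"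
        and eq: "gradient n D (\<phi> i) = gradient n D (\<phi> j)"
      define c :: "nat \<Rightarrow> 'a" where "c l = (if l = i then 1 else 0) - (if l = j then 1 else 0)" for l
      have "(\<Sum>l<r. c l * D k (\<phi> l)) = 0" if "k < n" for k
      proof -
        have "(\<Sum>l<r. c l * D k (\<phi> l)) =
            (\<Sum>l<r. if l = i then D k (\<phi> l) else 0) - (\<Sum>l<r. if l = j then D k (\<phi> l) else 0)"
          unfolding sum_subtractf[symmetric] by (intro sum.cong) (auto simp: c_def)
        also have "\<dots> = D k (\<phi> i) - D k (\<phi> j)"
          using ij by simp
        also have "\<dots> = 0"
          using arg_cong[OF eq, of "\<lambda>v. v $ k"] that by (simp add: gradient_def)
        finally show ?thesis .
      qed
      with R ij(1) have "c i = 0" by blast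
      with ij(3) show False by (simp add: c_def)
    qed
    then have dist: "distinct (cols M)"
      by (simp add: M_def cols_gradient_mat distinct_map atLeast0LessThan)
    moreover have "lin_indpt (set (cols M))"
    proof
      assume "lin_dep (set (cols M))"
      then obtain v where v: "v \<in> carrier_vec r" "v \<noteq> 0\<^sub>v r" "M *\<^sub>v v = 0\<^sub>v n"
        using lin_depE[OF M _ dist] by blast
      then have "\<forall>k<n. (\<Sum>j<r. v $ j * D k (\<phi> j)) = 0"
        by (simp flip: mult)
      with R have "\<forall>j<r. v $ j = 0" by blast
      with v(1) have "v = 0\<^sub>v r" by (intro eq_vecI) auto
      with v(2) show False by contradiction
    qed
    ultimately show ?L
      unfolding lin_indpt_family_iff_cols M_def by blast
  qed
qed

text \<open>
  If \<open>m \<le> n\<close> vectors, the rows of \<open>G\<close>, generate all unit vectors of the space of dimension \<open>n\<close>, then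
  they are linearly independent. Both matrices are padded with zeros to square ones, for which a left
  inverse is a right inverse.
\<close>

lemma left_inverse_rows_independent:
  fixes G B :: "nat \<Rightarrow> nat \<Rightarrow> 'a::field"
  assumes "m \<le> n"
    and inv: "\<And>i k. i < n \<Longrightarrow> k < n \<Longrightarrow> (\<Sum>j<m. B i j * G j k) = (if i = k then 1 else 0)"
    and rel: "\<And>k. k < n \<Longrightarrow> (\<Sum>j<m. c j * G j k) = 0"
    and j: "j < m"
  shows "c j = 0"
proof -
  define G' where "G' = mat n n (\<lambda>(j, k). if j < m then G j k else 0)"
  define B' where "B' = mat n n (\<lambda>(i, j). if j < m then B i j else 0)"
  define c' where "c' = mat 1 n (\<lambda>(_, j). if j < m then c j else 0)"
  have carrier [simp]: "G' \<in> carrier_mat n n" "B' \<in> carrier_mat n n" "c' \<in> carrier_mat 1 n"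
    by (simp_all add: G'_def B'_def c'_def)
  have pad: "(\<Sum>l = 0..<n. (if l < m then f l else 0) * (if l < m then g l else 0)) =
      (\<Sum>l<m. f l * g l)" for f g :: "nat \<Rightarrow> 'a"
    using \<open>m \<le> n\<close> by (intro sum.mono_neutral_cong_right) auto
  have "B' * G' = 1\<^sub>m n"
    by (rule eq_matI) (auto simp: B'_def G'_def scalar_prod_def pad inv)
  then have GB: "G' * B' = 1\<^sub>m n"
    by (rule mat_mult_left_right_inverse[rotated 2]) auto
  have "c' * G' = 0\<^sub>m 1 n"
    by (rule eq_matI) (auto simp: c'_def G'_def scalar_prod_def pad rel)
  then have "c' * (G' * B') = 0\<^sub>m 1 n * B'"
    using assoc_mult_mat[OF carrier(3,1,2)] by simp
  then have "c' = 0\<^sub>m 1 n"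
    by (simp only: GB right_mult_one_mat[OF carrier(3)] left_mult_zero_mat[OF carrier(2)])
  from arg_cong[OF this, of "\<lambda>A. A $$ (0, j)"] show ?thesis
    using j \<open>m \<le> n\<close> by (simp add: c'_def)
qed

section \<open>The Jacobian criterion\<close>

text \<open>
  If adjoining \<open>a\<close> makes an independent family dependent, then its gradient is a linear combination of the
  gradients of the family.
\<close>

lemma gradient_combination:
  fixes \<phi> :: "nat \<Rightarrow> 'a::field_char_0"
  assumes der: "\<And>k. k < n \<Longrightarrow> linear_derivation \<rat> (D k)"
    and ind: "independent_family m \<phi>"
    and dep: "\<not> independent_family (Suc m) (\<phi>(m := a))"
  shows "\<exists>b. \<forall>k<n. D k a = (\<Sum>j<m. b j * D k (\<phi> j))"
proof -
  let ?\<psi> = "\<phi>(m := a)"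
  obtain p where p: "p \<in> mpolynomials \<rat> (Suc m)" "p \<noteq> 0" "eval_mpolynomial ?\<psi> p = 0"
    and min: "\<And>j. partial_derivative j p \<noteq> 0 \<Longrightarrow>
      eval_mpolynomial ?\<psi> (partial_derivative j p) \<noteq> 0"
    using dep by (rule minimal_relation) blast
  \<comment> \<open>Otherwise \<open>p\<close> does not involve the variable of \<open>a\<close> and is a relation of the independent family.\<close>
  have "partial_derivative m p \<noteq> 0"
  proof
    assume zero: "partial_derivative m p = 0"
    have "p \<in> mpolynomials \<rat> m"
      unfolding mpolynomials_def
    proof (intro CollectI conjI allI ballI subsetI)
      show "Poly_Mapping.lookup p e \<in> \<rat>" for e
        using p(1) unfolding mpolynomials_def by blast
      fix e i assume e: "e \<in> Poly_Mapping.keys p" and i: "i \<in> Poly_Mapping.keys e"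
      from p(1) e have "Poly_Mapping.keys e \<subseteq> {..<Suc m}" unfolding mpolynomials_def by blast
      with i have "i < Suc m" by blast
      moreover have "i \<noteq> m"
        using lookup_zero_if_partial_derivative_zero[OF zero] e i unfolding in_keys_iff by blast
      ultimately show "i \<in> {..<m}" by simp
    qed
    moreover from this have "eval_mpolynomial \<phi> p = eval_mpolynomial ?\<psi> p"
      by (rule eval_mpolynomial_cong) simp
    with p(3) have "eval_mpolynomial \<phi> p = 0"
      by (rule trans[rotated])
    ultimately show False using ind p(2) unfolding independent_family_def by blast
  qed
  define q where "q j = eval_mpolynomial ?\<psi> (partial_derivative j p)" for j
  have q: "q m \<noteq> 0" unfolding q_def by (rule min) fact
  have "D k a = (\<Sum>j<m. (- q j / q m) * D k (\<phi> j))" if "k < n" for k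
  proof -
    have "(\<Sum>j<Suc m. q j * D k (?\<psi> j)) = D k (eval_mpolynomial ?\<psi> p)"
      unfolding q_def by (rule chain_rule[OF der[OF that] p(1), symmetric])
    also have "\<dots> = 0"
      unfolding p(3) by (rule linear_derivation_zero[OF der[OF that]])
    finally have "(\<Sum>j<m. q j * D k (\<phi> j)) + q m * D k a = 0"
      by simp
    then have "D k a = - (\<Sum>j<m. q j * D k (\<phi> j)) / q m"
      using q by (metis add.commute eq_neg_iff_add_eq_0 nonzero_mult_div_cancel_left)
    also have "\<dots> = (\<Sum>j<m. (- q j / q m) * D k (\<phi> j))"
      by (simp only: sum_negf[symmetric] sum_divide_distrib times_divide_eq_left mult_minus_left)
    finally show ?thesis .
  qed
  then show ?thesis by (intro exI[of _ "\<lambda>j. - q j / q m"] allI impI)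
qed

text \<open>
  Algebraic independence implies linear independence of the gradients: a maximal independent extension
  has at most \<open>n\<close> members, and its gradients generate the gradients of the generators, the unit vectors.
\<close>

lemma gradients_independent_if_independent_family:
  fixes x \<phi> :: "nat \<Rightarrow> 'a::field_char_0"
  assumes gen: "generate_field class_ring (x ` {..<n}) = UNIV"
    and der: "\<And>k. k < n \<Longrightarrow> linear_derivation \<rat> (D k)"
    and der_x: "\<And>i j. i < n \<Longrightarrow> j < n \<Longrightarrow> D i (x j) = (if i = j then 1 else 0)"
    and ind: "independent_family r \<phi>"
    and rel: "\<And>k. k < n \<Longrightarrow> (\<Sum>j<r. c j * D k (\<phi> j)) = 0"
    and j: "j < r"
  shows "c j = 0"
proof -
  \<comment> \<open>\<open>E m\<close>: the family extends to an independent one of length \<open>m\<close>.\<close>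
  define E where "E m \<longleftrightarrow> r \<le> m \<and> (\<exists>\<psi>. independent_family m \<psi> \<and> (\<forall>j<r. \<psi> j = \<phi> j))" for m
  have bound: "m \<le> n" if "E m" for m
    using that independent_family_length_le[OF gen] by (auto simp: E_def)
  have "E r" using ind by (auto simp: E_def)
  define m where "m = (GREATEST m. E m)"
  have "E m" unfolding m_def using \<open>E r\<close> bound by (rule GreatestI_nat)
  then obtain \<psi> where \<psi>: "independent_family m \<psi>" "\<And>j. j < r \<Longrightarrow> \<psi> j = \<phi> j" and "r \<le> m"
    by (auto simp: E_def)
  have "\<not> E (Suc m)"
  proof
    assume "E (Suc m)"
    then have "Suc m \<le> m" unfolding m_def by (rule Greatest_le_nat) (rule bound)
    then show False by simp
  qed
  have dep: "\<not> independent_family (Suc m) (\<psi>(m := a))" for a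
  proof
    assume "independent_family (Suc m) (\<psi>(m := a))"
    moreover have "\<forall>j<r. (\<psi>(m := a)) j = \<phi> j" using \<psi>(2) \<open>r \<le> m\<close> by simp
    ultimately have "E (Suc m)" unfolding E_def using \<open>r \<le> m\<close> by (blast intro: le_SucI)
    with \<open>\<not> E (Suc m)\<close> show False by contradiction
  qed
  have "\<forall>i. \<exists>b. \<forall>k<n. D k (x i) = (\<Sum>j<m. b j * D k (\<psi> j))"
    by (rule allI, rule gradient_combination[OF der \<psi>(1) dep])
  from choice[OF this] obtain b where
    "\<forall>i. \<forall>k<n. D k (x i) = (\<Sum>j<m. b i j * D k (\<psi> j))" ..
  then have b: "D k (x i) = (\<Sum>j<m. b i j * D k (\<psi> j))" if "k < n" for i k
    using that by simp
  define c' where "c' j = (if j < r then c j else 0)" for j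
  have "c' j = 0"
  proof (rule left_inverse_rows_independent[of m n b "\<lambda>j k. D k (\<psi> j)" c'])
    show "m \<le> n" by (rule bound) fact
    show "(\<Sum>j<m. b i j * D k (\<psi> j)) = (if i = k then 1 else 0)" if "i < n" "k < n" for i k
      using b[OF that(2), of i] der_x[OF that(2,1)] by auto
    show "(\<Sum>j<m. c' j * D k (\<psi> j)) = 0" if "k < n" for k
    proof -
      have "(\<Sum>j<m. c' j * D k (\<psi> j)) = (\<Sum>j<r. c j * D k (\<phi> j))"
        using \<open>r \<le> m\<close> \<psi>(2) by (intro sum.mono_neutral_cong_right) (auto simp: c'_def)
      with rel[OF that] show ?thesis by simp
    qed
    show "j < m" using j \<open>r \<le> m\<close> by simp
  qed
  with j show ?thesis by (simp add: c'_def)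
qed

lemma independent_family_iff_gradients:
  fixes x \<phi> :: "nat \<Rightarrow> 'a::field_char_0"
  assumes gen: "generate_field class_ring (x ` {..<n}) = UNIV"
    and der: "\<And>k. k < n \<Longrightarrow> linear_derivation \<rat> (D k)"
    and der_x: "\<And>i j. i < n \<Longrightarrow> j < n \<Longrightarrow> D i (x j) = (if i = j then 1 else 0)"
  shows "independent_family r \<phi> \<longleftrightarrow> lin_indpt_family n r (\<lambda>j. gradient n D (\<phi> j))"
proof
  assume "independent_family r \<phi>"
  then show "lin_indpt_family n r (\<lambda>j. gradient n D (\<phi> j))"
    unfolding lin_indpt_family_iff
    using gradients_independent_if_independent_family[OF gen der der_x] by simp
next
  assume "lin_indpt_family n r (\<lambda>j. gradient n D (\<phi> j))"
  then have indep: "\<forall>j<r. c j = 0" if "\<And>k. k < n \<Longrightarrow> (\<Sum>j<r. c j * D k (\<phi> j)) = 0" for c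
    using that unfolding lin_indpt_family_iff by simp
  show "independent_family r \<phi>"
    by (rule independent_family_if_gradients_independent[OF der indep])
qed

lemma lin_indpt_family_reindex:
  fixes v :: "'b \<Rightarrow> 'a::field vec"
  assumes "bij_betw \<phi> {..<r} \<Phi>" "bij_betw \<psi> {..<s} \<Phi>"
  shows "lin_indpt_family n r (\<lambda>j. v (\<phi> j)) \<longleftrightarrow> lin_indpt_family n s (\<lambda>j. v (\<psi> j))"
proof -
  have "lin_indpt_family n r (\<lambda>j. v (\<phi> j)) \<longleftrightarrow>
      inj_on v \<Phi> \<and> \<not> module.lin_dep class_ring (module_vec TYPE('a) n) (v ` \<Phi>)"
    if "bij_betw \<phi> {..<r} \<Phi>" for r :: nat and \<phi>
    using that comp_inj_on_iff[of \<phi> "{..<r}" v]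
    by (auto simp: lin_indpt_family_def bij_betw_def o_def image_image[symmetric])
  from this[OF assms(1)] this[OF assms(2)] show ?thesis by simp
qed

theorem proposition1:
  fixes n r :: nat
    and x \<phi> :: "nat \<Rightarrow> 'a::{field_char_0, order}"
    and D :: "nat \<Rightarrow> 'a \<Rightarrow> 'a"
    and \<Phi> :: "'a set"
  assumes order_add: "\<And>\<psi>1 \<psi>2 \<phi>1 \<phi>2 :: 'a. \<psi>1 > \<psi>2 \<Longrightarrow> \<phi>1 \<ge> \<phi>2 \<Longrightarrow> \<psi>1 + \<phi>1 > \<psi>2 + \<phi>2"
    and order_square: "\<And>\<psi> :: 'a. \<psi>\<^sup>2 \<ge> 0"
    and x_distinct: "inj_on x {..<n}"
    and x_not_0_1: "\<And>i. i < n \<Longrightarrow> x i \<noteq> 0 \<and> x i \<noteq> 1"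
    and x_generate: "generate_field class_ring (x ` {..<n}) = UNIV"
    and x_independent: "functionally_independent (x ` {..<n})"
    and derivation: "\<And>i. i < n \<Longrightarrow> linear_derivation prime_subfield (D i)"
    and derivation_x: "\<And>i j. i < n \<Longrightarrow> j < n \<Longrightarrow> D i (x j) = (if i = j then 1 else 0)"
    and enumeration: "bij_betw \<phi> {..<r} \<Phi>"
  shows "(functionally_independent \<Phi> \<longleftrightarrow> lin_indpt_family n r (\<lambda>j. gradient n D (\<phi> j))) \<and>
     (r > n \<longrightarrow> functionally_dependent \<Phi>) \<and>
     (\<forall>\<Psi> :: 'a set. functionally_independent \<Psi> \<longrightarrow> card \<Psi> \<le> n) \<and>
     (r \<le> n \<longrightarrow>
       (functionally_independent \<Phi> \<longleftrightarrow>
        vec_space.rank n (mat n r (\<lambda>(i, j). D i (\<phi> j))) = r))"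
proof -
  note der = derivation[unfolded prime_subfield_eq_Rats]
  have criterion: "independent_family s \<psi> \<longleftrightarrow> lin_indpt_family n s (\<lambda>j. gradient n D (\<psi> j))" for s \<psi>
    by (rule independent_family_iff_gradients[OF x_generate der derivation_x])
  have unfold: "functionally_independent \<Psi> \<longleftrightarrow> finite \<Psi> \<and>
      (\<forall>s \<psi>. bij_betw \<psi> {..<s} \<Psi> \<longrightarrow> independent_family s \<psi>)" for \<Psi> :: "'a set"
    by (auto simp: functionally_independent_def independent_family_def prime_subfield_eq_Rats)
  have fin: "finite \<Phi>" using bij_betw_finite[OF enumeration] by simp
  have part1: "functionally_independent \<Phi> \<longleftrightarrow> lin_indpt_family n r (\<lambda>j. gradient n D (\<phi> j))"
  proof
    assume "functionally_independent \<Phi>"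
    with enumeration have "independent_family r \<phi>" unfolding unfold by blast
    then show "lin_indpt_family n r (\<lambda>j. gradient n D (\<phi> j))" unfolding criterion .
  next
    assume L: "lin_indpt_family n r (\<lambda>j. gradient n D (\<phi> j))"
    \<comment> \<open>The criterion applies to every enumeration of \<open>\<Phi>\<close>, not just to the given one.\<close>
    have "independent_family s \<psi>" if "bij_betw \<psi> {..<s} \<Phi>" for s \<psi>
      using L unfolding criterion lin_indpt_family_reindex[OF enumeration that] .
    with fin show "functionally_independent \<Phi>" unfolding unfold by blast
  qed
  have bound: "card \<Psi> \<le> n" if "functionally_independent \<Psi>" for \<Psi> :: "'a set"
  proof -
    from that have "finite \<Psi>" by (simp add: functionally_independent_def)
    then obtain \<psi> where "bij_betw \<psi> {..<card \<Psi>} \<Psi>"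
      using ex_bij_betw_nat_finite[of \<Psi>] by (auto simp: atLeast0LessThan)
    with that have "independent_family (card \<Psi>) \<psi>" unfolding unfold by blast
    then show ?thesis by (rule independent_family_length_le[OF x_generate])
  qed
  have "card \<Phi> = r" using bij_betw_same_card[OF enumeration] by simp
  with bound[of \<Phi>] fin have "r > n \<longrightarrow> functionally_dependent \<Phi>"
    by (auto simp: functionally_dependent_def)
  with part1 bound show ?thesis by (simp add: lin_indpt_family_iff_rank)
qed

end
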